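(* If $|s_1t_1z_1+\cdots+s_rt_rz_r|<1$ and $a,b,c$ are defined by \[ a=s_1x_1+\cdots+s_rx_r,\qquad b=t_1y_1+\cdots+t_ry_r,\qquad c=s_1t_1z_1+\cdots+s_rt_rz_r, \] then the following multilinear generating function for the complex Hermite polynomials holds: \[ \frac{1}{1-cz}\exp\left(\frac{ax+by+cxy+abz}{1-cz}\right) \] \[ =\sum_{m_1,n_1,\ldots,m_r,n_r=0}^\infty H_{m_1,n_1}(x_1,y_1,z_1)\cdots H_{m_r,n_r}(x_r,y_r,z_r)\,H_{m_1+\cdots+m_r,\;n_1+\cdots+n_r}(x,y,z)\,\frac{s_1^{m_1}t_1^{n_1}\cdots s_r^{m_r}t_r^{n_r}}{m_1!\,n_1!\cdots m_r!\,n_r!}. \]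
   Context: Here $r$ is a positive integer, and $x,y,z$ and $s_j,t_j,x_j,y_j,z_j$ ($1\le j\le r$) are complex numbers. For complex numbers $x,y,z$ and non-negative integers $m,n$, the (three-variable) complex Hermite polynomials are defined by \[ H_{m,n}(x,y,z)=\sum_{k=0}^{\min\{m,n\}} k!\binom{m}{k}\binom{n}{k}x^{m-k}y^{n-k}z^k . \]
   Formalization: The condition |cz|<1 is added (for r=1, x=y=x_1=y_1=0 the series is the sum of (cz)^m); the series is summed by grouping terms with equal totals of the m_j and of the n_j, and without grouping when the sum of |s_j t_j z_j z| is below 1. *)

theory Defs
  imports "HOL-Analysis.Analysis"
begin

definition complex_hermite :: "nat \<Rightarrow> nat \<Rightarrow> complex \<Rightarrow> complex \<Rightarrow> complex \<Rightarrow> complex" where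
  "complex_hermite m n x y z =
     (\<Sum>k = 0..min m n.
        fact k * of_nat (m choose k) * of_nat (n choose k) * x ^ (m - k) * y ^ (n - k) * z ^ k)"

text \<open>An \<open>r\<close>-tuple of naturals is a function that is undefined outside \<open>{1..r}\<close>, so that
  every tuple is represented exactly once as a summation index.\<close>

definition multi_indices :: "nat \<Rightarrow> (nat \<Rightarrow> nat) set" where
  "multi_indices r = {1..r} \<rightarrow>\<^sub>E UNIV"

text \<open>The pairs \<open>(m, n)\<close> of tuples with prescribed totals \<open>M\<close> and \<open>N\<close>; there are only
  finitely many.\<close>

definition index_block :: "nat \<Rightarrow> nat \<times> nat \<Rightarrow> ((nat \<Rightarrow> nat) \<times> (nat \<Rightarrow> nat)) set" where
  "index_block r = (\<lambda>(M, N). {(m, n). m \<in> multi_indices r \<and> n \<in> multi_indices r \<and>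
     (\<Sum>j = 1..r. m j) = M \<and> (\<Sum>j = 1..r. n j) = N})"

lemma finite_index_block: "finite (index_block r p)"
proof -
  obtain M N where p: "p = (M, N)" by (cases p)
  have "m \<in> {1..r} \<rightarrow>\<^sub>E {..K}" if "m \<in> multi_indices r" "(\<Sum>j = 1..r. m j) = K" for m K
  proof (rule PiE_I)
    fix j assume "j \<in> {1..r}"
    then have "m j \<le> (\<Sum>j = 1..r. m j)" by (intro member_le_sum) auto
    with that show "m j \<in> {..K}" by simp
  next
    fix j assume "j \<notin> {1..r}"
    then show "m j = undefined" using that by (auto simp: multi_indices_def PiE_def extensional_def)
  qed
  then have "index_block r p \<subseteq> ({1..r} \<rightarrow>\<^sub>E {..M}) \<times> ({1..r} \<rightarrow>\<^sub>E {..N})"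
    unfolding index_block_def p by blast
  then show ?thesis
    by (rule finite_subset) (intro finite_cartesian_product finite_PiE; simp)
qed

end

theory Submission
  imports Defs "HOL-Computational_Algebra.Formal_Power_Series"
begin

text \<open>
  The normalised polynomials \<open>H\<^sub>m\<^sub>,\<^sub>n(x, y, z) / (m! n!)\<close> are the coefficients of
  \<open>exp (x u + y v + z u v)\<close>. Multiplying \<open>r\<close> such series shows that summing the multilinear series
  over all indices with fixed totals \<open>(M, N)\<close> leaves
  \<open>H\<^sub>M\<^sub>,\<^sub>N(x, y, z) H\<^sub>M\<^sub>,\<^sub>N(a, b, c) / (M! N!)\<close>. To sum this over \<open>M\<close> and \<open>N\<close>, expand
  \<open>H\<^sub>M\<^sub>,\<^sub>N(a, b, c)\<close> in powers \<open>c\<^sup>l\<close>: the coefficient of \<open>c\<^sup>l / l!\<close> is the shifted generating function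
  \<open>\<Sum> H\<^sub>m\<^sub>+\<^sub>l\<^sub>,\<^sub>n\<^sub>+\<^sub>l(x, y, z) a\<^sup>m b\<^sup>n / (m! n!) = H\<^sub>l\<^sub>,\<^sub>l(x + b z, y + a z, z) exp (a x + b y + a b z)\<close>,
  and the remaining series over \<open>l\<close> is a Laguerre-type generating function, which reduces to the negative
  binomial and exponential series. Every interchange of summations is justified by comparison with
  the same identity at the absolute values of all arguments.
\<close>

section \<open>Unordered double sums: domination and reindexing\<close>

text \<open>An iterated sum alone does not give a sum over \<open>Sigma A B\<close>. Condition
  \<open>le\<close> makes \<open>Re h\<close> nonnegative there, so its iterated summability is
  joint summability, which comparison passes on to \<open>f\<close>. The majorant is complex-valued
  so that an identity proved for \<open>f\<close> can be reused for it at absolute values.\<close>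

lemma has_sum_Sigma_dominated:
  fixes f h :: "'a \<times> 'b \<Rightarrow> complex"
  assumes f: "\<And>a. a \<in> A \<Longrightarrow> ((\<lambda>b. f (a, b)) has_sum g a) (B a)" and g: "(g has_sum S) A"
    and h: "\<And>a. a \<in> A \<Longrightarrow> ((\<lambda>b. h (a, b)) has_sum k a) (B a)" and k: "k summable_on A"
    and le: "\<And>a b. a \<in> A \<Longrightarrow> b \<in> B a \<Longrightarrow> norm (f (a, b)) \<le> Re (h (a, b))"
  shows "(f has_sum S) (Sigma A B)"
proof -
  have "(\<lambda>p. Re (h p)) summable_on Sigma A B"
  proof (rule summable_on_SigmaI)
    show "((\<lambda>b. Re (h (a, b))) has_sum Re (k a)) (B a)" if "a \<in> A" for a
      using h[OF that] by (rule has_sum_Re)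
    show "(\<lambda>a. Re (k a)) summable_on A" using k by (rule summable_on_Re)
    show "0 \<le> Re (h (a, b))" if "a \<in> A" "b \<in> B a" for a b
      using le[OF that] norm_ge_zero order_trans by blast
  qed
  then have "(\<lambda>p. norm (f p)) summable_on Sigma A B"
    by (rule Infinite_Sum.abs_summable_on_comparison_test') (use le in auto)
  then have "f summable_on Sigma A B" by (rule abs_summable_summable)
  with f g show ?thesis by (rule has_sum_SigmaI)
qed

text \<open>Complex summability is absolute, so the product of the norms is a summable
  majorant.\<close>

lemma has_sum_mult_complex:
  fixes f :: "'a \<Rightarrow> complex" and g :: "'b \<Rightarrow> complex"
  assumes f: "(f has_sum S) A" and g: "(g has_sum T) B"
  shows "((\<lambda>(a, b). f a * g b) has_sum S * T) (A \<times> B)"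
proof (rule has_sum_Sigma_dominated)
  let ?h = "\<lambda>(a, b). of_real (norm (f a)) * of_real (norm (g b)) :: complex"
  have norm_summable: "(\<lambda>x. of_real (norm (u x)) :: complex) summable_on C"
    if "(u has_sum U) C" for u :: "'c \<Rightarrow> complex" and U C
    using that has_sum_imp_summable summable_on_iff_abs_summable_on_complex summable_on_of_real by blast
  show "((\<lambda>b. case (a, b) of (a, b) \<Rightarrow> f a * g b) has_sum f a * T) B" for a
    using has_sum_cmult_right[OF g] by simp
  show "((\<lambda>a. f a * T) has_sum S * T) A"
    using f by (rule has_sum_cmult_left)
  show "((\<lambda>b. ?h (a, b)) has_sum
      of_real (norm (f a)) * infsum (\<lambda>b. of_real (norm (g b))) B) B" for a
    using has_sum_cmult_right[OF has_sum_infsum[OF norm_summable[OF g]]] by simp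
  show "(\<lambda>a. of_real (norm (f a)) * infsum (\<lambda>b. of_real (norm (g b)) :: complex) B) summable_on A"
    using norm_summable[OF f] by (rule summable_on_cmult_left)
qed (simp add: norm_mult)

lemma has_sum_antidiagonal:
  fixes f :: "nat \<times> nat \<Rightarrow> complex"
  assumes "(f has_sum S) UNIV"
  shows "((\<lambda>l. \<Sum>k\<le>l. f (l - k, k)) has_sum S) UNIV"
proof (rule has_sum_SigmaD)
  show "((\<lambda>(l, k). f (l - k, k)) has_sum S) (SIGMA l:UNIV. {..l})"
    using assms
    by (subst has_sum_reindex_bij_witness
        [where i = "\<lambda>(p, k). (p + k, k)" and j = "\<lambda>(l, k). (l - k, k)" and T = UNIV and h = f]) auto
qed simp

text \<open>Pairs \<open>(m, n)\<close> with a marked \<open>k \<le> min m n\<close> correspond to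
  free triples \<open>(k, m - k, n - k)\<close>; this is the summation range in
  \<open>complex_hermite\<close>.\<close>

lemma has_sum_diagonal_shift:
  fixes f :: "nat \<times> nat \<times> nat \<Rightarrow> complex"
  assumes "(f has_sum S) UNIV"
  shows "((\<lambda>(m, n). \<Sum>k = 0..min m n. f (k, m - k, n - k)) has_sum S) UNIV"
proof (rule has_sum_SigmaD)
  show "((\<lambda>((m, n), k). f (k, m - k, n - k)) has_sum S) (SIGMA p:UNIV. {0..min (fst p) (snd p)})"
    using assms
    by (subst has_sum_reindex_bij_witness
        [where i = "\<lambda>(k, m, n). ((m + k, n + k), k)" and j = "\<lambda>((m, n), k). (k, m - k, n - k)"
          and T = UNIV and h = f]) auto
qed (auto simp: case_prod_unfold)

section \<open>Exponential and negative binomial series\<close>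

lemma has_sum_exp:
  fixes w :: complex
  shows "((\<lambda>n. w ^ n / fact n) has_sum exp w) UNIV"
proof (rule norm_summable_imp_has_sum)
  show "summable (\<lambda>n. norm (w ^ n / fact n))"
    using summable_norm_exp[of w] by (simp add: scaleR_conv_of_real norm_mult norm_divide divide_simps norm_power)
  show "(\<lambda>n. w ^ n / fact n) sums exp w"
    using exp_converges[of w] by (simp add: scaleR_conv_of_real divide_simps)
qed

text \<open>This is the binomial series with exponent \<open>- Suc p\<close>; negating the upper
  index of \<open>gchoose\<close> gives the coefficients.\<close>

lemma has_sum_negative_binomial:
  fixes w :: complex
  assumes "norm w < 1"
  shows "((\<lambda>k. of_nat ((p + k) choose k) * w ^ k) has_sum (1 / (1 - w)) ^ Suc p) UNIV"
proof -
  have coeff: "(- of_nat (Suc p) gchoose k) * (- u) ^ k = of_nat ((p + k) choose k) * u ^ k"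
    for k and u :: complex
  proof -
    have "(- of_nat (Suc p) gchoose k :: complex) = (-1) ^ k * (of_nat (p + k) gchoose k)"
      by (subst gbinomial_minus) simp
    then show ?thesis
      by (simp add: binomial_gbinomial power_minus[of u])
  qed
  have sums: "(\<lambda>k. of_nat ((p + k) choose k) * u ^ k) sums (1 - u) powr (- of_nat (Suc p))"
    if "norm u < 1" for u :: complex
    using gen_binomial_complex[of "- u" "- of_nat (Suc p)"] that by (simp only: coeff) simp
  \<comment> \<open>Convergence at a radius larger than \<open>norm w\<close> yields absolute
    convergence at \<open>w\<close>, which upgrades \<open>sums\<close> to
    \<open>has_sum\<close>.\<close>
  obtain \<rho> where \<rho>: "norm w < \<rho>" "\<rho> < 1" using assms dense by blast
  then have \<rho>_norm: "norm (complex_of_real \<rho>) = \<rho>"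
    using norm_ge_zero[of w] by (simp del: norm_ge_zero)
  have "summable (\<lambda>k. of_nat ((p + k) choose k) * complex_of_real \<rho> ^ k)"
    using sums[of "of_real \<rho>"] \<rho> \<rho>_norm by (auto dest: sums_summable)
  then have "summable (\<lambda>k. norm (of_nat ((p + k) choose k) * w ^ k))"
    by (rule powser_insidea) (use \<rho> \<rho>_norm in simp)
  moreover have "(1 - w) powr (- of_nat (Suc p)) = (1 / (1 - w)) ^ Suc p"
  proof -
    have "1 - w \<noteq> 0" using assms by auto
    then show ?thesis
      by (simp add: powr_minus powr_nat divide_simps del: of_nat_Suc)
  qed
  ultimately show ?thesis
    using sums[OF assms] by (metis norm_summable_imp_has_sum)
qed

section \<open>Symmetry, recurrence, homogeneity and addition formula\<close>

lemma complex_hermite_swap: "complex_hermite m n x y z = complex_hermite n m y x z"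
  by (simp add: complex_hermite_def min.commute mult_ac)

lemma complex_hermite_0_0 [simp]: "complex_hermite 0 0 x y z = 1"
  by (simp add: complex_hermite_def)

lemma complex_hermite_div_fact:
  "complex_hermite m n x y z / (fact m * fact n) =
     (\<Sum>k = 0..min m n. x ^ (m - k) * y ^ (n - k) * z ^ k / (fact k * fact (m - k) * fact (n - k)))"
  unfolding complex_hermite_def sum_divide_distrib
  by (rule sum.cong) (auto simp: binomial_fact field_simps)

text \<open>For fixed \<open>m\<close>, the exponential generating function in \<open>n\<close> is
  \<open>(x + z X)\<^sup>m exp (y X)\<close>; both the recurrence and the addition formula are read off from it.\<close>

lemma complex_hermite_fps:
  "fps_nth ((fps_const x + fps_const z * fps_X) ^ m * fps_exp y) n = complex_hermite m n x y z / fact n"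
proof -
  have "fps_nth ((fps_const x + fps_const z * fps_X) ^ m * fps_exp y) n =
      (\<Sum>k\<le>m. fps_nth (fps_const (of_nat (m choose k) * z ^ k * x ^ (m - k)) *
         (fps_X ^ k * fps_exp y)) n)"
    by (subst add.commute, subst binomial_ring)
      (simp add: sum_distrib_right sum_distrib_left fps_sum_nth power_mult_distrib fps_const_power mult_ac
        flip: fps_const_mult fps_of_nat)
  also have "\<dots> = (\<Sum>k\<le>m. if n < k then 0
      else of_nat (m choose k) * z ^ k * x ^ (m - k) * (y ^ (n - k) / fact (n - k)))"
    by (intro sum.cong) (auto simp: fps_X_power_mult_nth)
  also have "\<dots> = (\<Sum>k = 0..min m n.
      of_nat (m choose k) * z ^ k * x ^ (m - k) * (y ^ (n - k) / fact (n - k)))"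
    by (rule sum.mono_neutral_cong_right) auto
  also have "\<dots> = complex_hermite m n x y z / fact n"
    unfolding complex_hermite_def sum_divide_distrib
    by (rule sum.cong) (auto simp: binomial_fact field_simps)
  finally show ?thesis .
qed

text \<open>One factor \<open>x + z X\<close> is split off the generating function; its
  \<open>X\<close> term lowers the coefficient index by one. The truncated \<open>n - 1\<close> at
  \<open>n = 0\<close> is harmless because of the factor \<open>of_nat n\<close>.\<close>

lemma complex_hermite_Suc_left:
  "complex_hermite (Suc m) n x y z =
     x * complex_hermite m n x y z + of_nat n * z * complex_hermite m (n - 1) x y z"
proof -
  let ?g = "fps_const x + fps_const z * fps_X"
  have "complex_hermite (Suc m) n x y z / fact n = fps_nth (?g * (?g ^ m * fps_exp y)) n"
    by (simp add: complex_hermite_fps flip: mult.assoc power_Suc)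
  also have "\<dots> = x * (complex_hermite m n x y z / fact n) +
      (if n = 0 then 0 else z * (complex_hermite m (n - 1) x y z / fact (n - 1)))"
    by (simp add: distrib_right mult.assoc complex_hermite_fps)
  finally have *: "complex_hermite (Suc m) n x y z = fact n * \<dots>"
    by (simp add: field_simps)
  show ?thesis
    by (subst *, cases n) (auto simp: distrib_left simp del: of_nat_Suc)
qed

text \<open>Each monomial gains degree \<open>m\<close> in \<open>u\<close> and \<open>n\<close> in
  \<open>v\<close>, as \<open>x\<close> carries \<open>u\<close>, \<open>y\<close> carries
  \<open>v\<close> and \<open>z\<close> carries both.\<close>

lemma complex_hermite_scale:
  "complex_hermite m n (u * x) (v * y) (u * v * z) = u ^ m * v ^ n * complex_hermite m n x y z"
proof -
  have "(u * x) ^ (m - k) * (v * y) ^ (n - k) * (u * v * z) ^ k =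
      u ^ m * v ^ n * (x ^ (m - k) * y ^ (n - k) * z ^ k)" if "k \<le> min m n" for k
  proof -
    have "u ^ m = u ^ (m - k) * u ^ k" "v ^ n = v ^ (n - k) * v ^ k"
      using that by (simp_all flip: power_add)
    then show ?thesis by (simp add: power_mult_distrib mult_ac)
  qed
  then show ?thesis
    unfolding complex_hermite_def sum_distrib_left by (intro sum.cong) (auto simp: mult_ac)
qed

text \<open>The binomial theorem splits the power of the sum of two linear factors, and the
  exponentials multiply; the product of series is the convolution in the second index.\<close>

lemma complex_hermite_add:
  "complex_hermite m n (x + x') (y + y') (z + z') / (fact m * fact n) =
     (\<Sum>i\<le>m. \<Sum>j\<le>n. complex_hermite i j x y z / (fact i * fact j) *
        (complex_hermite (m - i) (n - j) x' y' z' / (fact (m - i) * fact (n - j))))"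
proof -
  let ?g = "fps_const x + fps_const z * fps_X" and ?g' = "fps_const x' + fps_const z' * fps_X"
  have "complex_hermite m n (x + x') (y + y') (z + z') / fact n =
      fps_nth ((?g + ?g') ^ m * (fps_exp y * fps_exp y')) n"
    by (simp add: add_ac distrib_right flip: complex_hermite_fps fps_exp_add_mult fps_const_add)
  also have "\<dots> = (\<Sum>i\<le>m. fps_nth (fps_const (of_nat (m choose i)) *
      ((?g ^ i * fps_exp y) * (?g' ^ (m - i) * fps_exp y'))) n)"
    by (subst binomial_ring) (simp add: sum_distrib_right sum_distrib_left fps_sum_nth mult_ac flip: fps_of_nat)
  also have "\<dots> = (\<Sum>i\<le>m. of_nat (m choose i) * (\<Sum>j\<le>n. complex_hermite i j x y z / fact j *
      (complex_hermite (m - i) (n - j) x' y' z' / fact (n - j))))"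
    by (subst fps_mult_left_const_nth, subst fps_mult_nth) (simp add: complex_hermite_fps atLeast0AtMost)
  finally have "complex_hermite m n (x + x') (y + y') (z + z') / fact n / fact m = \<dots> / fact m"
    by simp
  also have "\<dots> = (\<Sum>i\<le>m. \<Sum>j\<le>n. complex_hermite i j x y z / (fact i * fact j) *
        (complex_hermite (m - i) (n - j) x' y' z' / (fact (m - i) * fact (n - j))))"
    unfolding sum_divide_distrib sum_distrib_left
    by (intro sum.cong refl) (auto simp: binomial_fact field_simps)
  finally show ?thesis by (simp add: mult.commute)
qed

section \<open>Majorants at absolute values\<close>

text \<open>A real copy of the polynomials, so that their values at absolute values can be ordered
  and serve as bounds.\<close>

definition real_hermite :: "nat \<Rightarrow> nat \<Rightarrow> real \<Rightarrow> real \<Rightarrow> real \<Rightarrow> real" where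
  "real_hermite m n x y z =
     (\<Sum>k = 0..min m n.
        fact k * of_nat (m choose k) * of_nat (n choose k) * x ^ (m - k) * y ^ (n - k) * z ^ k)"

lemma complex_hermite_of_real:
  "complex_hermite m n (of_real x) (of_real y) (of_real z) = of_real (real_hermite m n x y z)"
  by (simp add: complex_hermite_def real_hermite_def)

lemma norm_complex_hermite_le:
  "norm (complex_hermite m n x y z) \<le> real_hermite m n (norm x) (norm y) (norm z)"
  unfolding complex_hermite_def real_hermite_def
  by (rule order_trans[OF norm_sum], rule sum_mono) (simp add: norm_mult norm_power)

section \<open>The shifted generating function\<close>

text \<open>The shifts leave powers and factorials alone, so these are the terms of the formal
  derivative of order \<open>(p, q)\<close> in \<open>(a, b)\<close> of the unshifted generating
  function.\<close>

definition hermite_term ::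
    "complex \<Rightarrow> complex \<Rightarrow> complex \<Rightarrow> complex \<Rightarrow> complex \<Rightarrow> nat \<Rightarrow> nat \<Rightarrow> nat \<times> nat \<Rightarrow> complex" where
  "hermite_term x y z a b p q =
     (\<lambda>(m, n). complex_hermite (m + p) (n + q) x y z * a ^ m * b ^ n / (fact m * fact n))"

text \<open>The exponential series of \<open>a * b * z\<close>, \<open>a * x\<close> and
  \<open>b * y\<close> are multiplied and regrouped by the diagonal shift; homogeneity moves
  \<open>a\<close> and \<open>b\<close> out of the arguments.\<close>

lemma has_sum_hermite_term_0_0:
  "(hermite_term x y z a b 0 0 has_sum exp (a * x + b * y + a * b * z)) UNIV"
proof -
  let ?e = "\<lambda>w n. w ^ n / fact n :: complex"
  have "((\<lambda>(k, m, n). ?e (a * b * z) k * (?e (a * x) m * ?e (b * y) n)) has_sum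
      exp (a * b * z) * (exp (a * x) * exp (b * y))) (UNIV \<times> (UNIV \<times> UNIV))"
    using has_sum_mult_complex[OF has_sum_exp has_sum_mult_complex[OF has_sum_exp has_sum_exp],
        of "a * b * z" "a * x" "b * y"]
    by (simp add: case_prod_unfold)
  then have "((\<lambda>(m, n). \<Sum>k = 0..min m n.
      ?e (a * b * z) k * (?e (a * x) (m - k) * ?e (b * y) (n - k))) has_sum
      exp (a * b * z) * (exp (a * x) * exp (b * y))) UNIV"
    using has_sum_diagonal_shift by fastforce
  moreover have "(\<Sum>k = 0..min m n. ?e (a * b * z) k * (?e (a * x) (m - k) * ?e (b * y) (n - k))) =
      hermite_term x y z a b 0 0 (m, n)" for m n
  proof -
    have "hermite_term x y z a b 0 0 (m, n) =
        complex_hermite m n (a * x) (b * y) (a * b * z) / (fact m * fact n)"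
      using complex_hermite_scale[of m n a x b y z] by (simp add: hermite_term_def mult_ac)
    then show ?thesis
      by (simp add: complex_hermite_div_fact mult_ac)
  qed
  ultimately have "((\<lambda>(m, n). hermite_term x y z a b 0 0 (m, n)) has_sum
      exp (a * b * z) * (exp (a * x) * exp (b * y))) UNIV"
    by (simp only:)
  then show ?thesis
    by (simp add: exp_add mult_ac)
qed

text \<open>The \<open>n = 0\<close> term vanishes; elsewhere \<open>n / n! = 1 / (n - 1)!\<close>,
  so lowering the index by one leaves exactly a factor \<open>b\<close>.\<close>

lemma has_sum_shift_snd:
  fixes F :: "nat \<Rightarrow> nat \<Rightarrow> complex"
  assumes "((\<lambda>(m, n). F m n * a ^ m * b ^ n / (fact m * fact n)) has_sum S) UNIV"
  shows "((\<lambda>(m, n). of_nat n * F m (n - 1) * a ^ m * b ^ n / (fact m * fact n)) has_sum b * S) UNIV"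
proof -
  let ?f = "\<lambda>(m, n). of_nat n * F m (n - 1) * a ^ m * b ^ n / (fact m * fact n)"
  have "((\<lambda>p. b * (case p of (m, n) \<Rightarrow> F m n * a ^ m * b ^ n / (fact m * fact n))) has_sum b * S) UNIV"
    using assms by (rule has_sum_cmult_right)
  also have "?this \<longleftrightarrow> (?f has_sum b * S) (UNIV \<times> {1..})"
    by (rule has_sum_reindex_bij_witness[where i = "\<lambda>(m, n). (m, n - 1)" and j = "\<lambda>(m, n). (m, Suc n)"])
      (auto simp: field_simps simp del: of_nat_Suc)
  also have "\<dots> \<longleftrightarrow> (?f has_sum b * S) UNIV"
    by (rule has_sum_cong_neutral) (auto simp: not_le)
  finally show ?thesis .
qed

text \<open>The recurrence contributes a factor \<open>n + q\<close>. Its \<open>n\<close> part is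
  an index shift worth \<open>b * z * S\<close>, which turns \<open>x\<close> into
  \<open>x + b * z\<close>; its \<open>q\<close> part is the series with
  \<open>q - 1\<close>.\<close>

lemma has_sum_hermite_term_Suc_left:
  assumes 1: "(hermite_term x y z a b p q has_sum S) UNIV"
    and 2: "q > 0 \<Longrightarrow> (hermite_term x y z a b p (q - 1) has_sum S') UNIV"
  shows "(hermite_term x y z a b (Suc p) q has_sum (x + b * z) * S + of_nat q * z * S') UNIV"
proof -
  have shift: "((\<lambda>(m, n). of_nat n * complex_hermite (m + p) (n - 1 + q) x y z * a ^ m * b ^ n /
      (fact m * fact n)) has_sum b * S) UNIV"
    using 1 unfolding hermite_term_def by (rule has_sum_shift_snd)
  \<comment> \<open>For \<open>q = 0\<close> nothing is known about \<open>S'\<close>, but all terms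
    and the claimed value are zero.\<close>
  have q: "((\<lambda>(m, n). of_nat q * z * hermite_term x y z a b p (q - 1) (m, n)) has_sum of_nat q * z * S') UNIV"
    using has_sum_cmult_right[OF 2, of "of_nat q * z"] by (cases "q = 0") (auto simp: case_prod_unfold)
  let ?G = "\<lambda>mn. x * hermite_term x y z a b p q mn +
      z * (case mn of (m, n) \<Rightarrow> of_nat n * complex_hermite (m + p) (n - 1 + q) x y z * a ^ m * b ^ n /
        (fact m * fact n)) +
      (case mn of (m, n) \<Rightarrow> of_nat q * z * hermite_term x y z a b p (q - 1) (m, n))"
  have "(?G has_sum x * S + z * (b * S) + of_nat q * z * S') UNIV"
    by (intro has_sum_add has_sum_cmult_right 1 shift q)
  also have "?G = hermite_term x y z a b (Suc p) q"
  proof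
    fix mn :: "nat \<times> nat"
    obtain m n where mn: "mn = (m, n)" by (cases mn)
    let ?H = "complex_hermite (m + p) (n + q) x y z" and ?H' = "complex_hermite (m + p) (n + q - 1) x y z"
    let ?w = "a ^ m * b ^ n / (fact m * fact n)"
    \<comment> \<open>Truncated subtraction: \<open>n - 1 + q\<close> and \<open>n + q - 1\<close>
      can differ only at \<open>n = 0\<close>, where the factor is zero; likewise for
      \<open>q\<close> below.\<close>
    have n: "of_nat n * complex_hermite (m + p) (n - 1 + q) x y z = of_nat n * ?H'"
      by (cases n) auto
    have q: "of_nat q * complex_hermite (m + p) (n + (q - 1)) x y z = of_nat q * ?H'"
      by (cases q) auto
    have "?G mn = (x * ?H + z * (of_nat n * complex_hermite (m + p) (n - 1 + q) x y z) +
        z * (of_nat q * complex_hermite (m + p) (n + (q - 1)) x y z)) * ?w"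
      by (simp add: mn hermite_term_def add_divide_distrib algebra_simps)
    also have "\<dots> = (x * ?H + of_nat (n + q) * z * ?H') * ?w"
      unfolding n q by (simp add: algebra_simps)
    also have "\<dots> = hermite_term x y z a b (Suc p) q mn"
      by (simp add: mn hermite_term_def complex_hermite_Suc_left)
    finally show "?G mn = hermite_term x y z a b (Suc p) q mn" .
  qed
  finally show ?thesis by (simp add: algebra_simps)
qed

lemma has_sum_hermite_term_swap:
  "(hermite_term x y z a b p q has_sum S) UNIV \<longleftrightarrow> (hermite_term y x z b a q p has_sum S) UNIV"
  by (rule has_sum_reindex_bij_witness[where i = prod.swap and j = prod.swap])
    (auto simp: hermite_term_def complex_hermite_swap[of _ _ y] mult_ac)

text \<open>The step from \<open>p\<close> to \<open>Suc p\<close> is the Hermite recurrence with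
  \<open>x + b * z\<close> in place of \<open>x\<close>, so both sides obey the same recursion in
  \<open>p\<close> and, by symmetry, in \<open>q\<close>.\<close>

lemma has_sum_hermite_term:
  "(hermite_term x y z a b p q has_sum
      complex_hermite p q (x + b * z) (y + a * z) z * exp (a * x + b * y + a * b * z)) UNIV"
proof (induction p arbitrary: q)
  case 0
  \<comment> \<open>The induction on \<open>q\<close> runs on the swapped series; its second shift
    is 0, so the \<open>S'\<close> term drops out.\<close>
  have "(hermite_term y x z b a q 0 has_sum
      complex_hermite q 0 (y + a * z) (x + b * z) z * exp (b * y + a * x + b * a * z)) UNIV"
  proof (induction q)
    case 0
    show ?case using has_sum_hermite_term_0_0[of y x z b a] by simp
  next
    case (Suc q)
    show ?case
      using has_sum_hermite_term_Suc_left[OF Suc] by (simp add: complex_hermite_Suc_left mult_ac)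
  qed
  then show ?case
    by (subst has_sum_hermite_term_swap) (simp add: complex_hermite_swap[of q] add_ac mult_ac)
next
  case (Suc p)
  show ?case
    using has_sum_hermite_term_Suc_left[OF Suc Suc, of q] by (simp add: complex_hermite_Suc_left algebra_simps)
qed

section \<open>Diagonal series and the bilinear formula\<close>

text \<open>Since \<open>k! binom(l, k)^2 / l! = binom(l, k) / (l - k)!\<close>, setting
  \<open>l = p + k\<close> turns the terms into \<open>(c x y)^p / p!\<close> times
  \<open>binom(p + k, k) (c z)^k\<close>. The sum over \<open>k\<close> is a negative binomial
  series and the remaining one over \<open>p\<close> exponential.\<close>

lemma has_sum_diagonal_hermite:
  assumes cz: "norm (c * z) < 1"
  shows "((\<lambda>l. c ^ l / fact l * complex_hermite l l x y z) has_sum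
    1 / (1 - c * z) * exp (c * x * y / (1 - c * z))) UNIV"
proof -
  let ?f = "\<lambda>u v (p, k). u ^ p / fact p * (of_nat ((p + k) choose k) * v ^ k) :: complex"
  have inner: "((\<lambda>k. ?f u v (p, k)) has_sum u ^ p / fact p * (1 / (1 - v)) ^ Suc p) UNIV"
    if "norm v < 1" for u v p
    using has_sum_cmult_right[OF has_sum_negative_binomial[OF that], of "u ^ p / fact p" p]
    by (simp only: prod.case)
  have outer: "((\<lambda>p. u ^ p / fact p * (1 / (1 - v)) ^ Suc p) has_sum
      1 / (1 - v) * exp (u / (1 - v))) UNIV" for u v :: complex
    using has_sum_cmult_right[OF has_sum_exp[of "u / (1 - v)"], of "1 / (1 - v)"]
    by (simp add: power_divide mult_ac)
  let ?u = "c * x * y" and ?v = "c * z"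
  have "(?f ?u ?v has_sum 1 / (1 - ?v) * exp (?u / (1 - ?v))) (UNIV \<times> UNIV)"
  proof (rule has_sum_Sigma_dominated)
    let ?U = "of_real (norm ?u) :: complex" and ?V = "of_real (norm ?v) :: complex"
    show "((\<lambda>k. ?f ?U ?V (p, k)) has_sum ?U ^ p / fact p * (1 / (1 - ?V)) ^ Suc p) UNIV" for p
      by (rule inner) (use cz in simp)
    show "(\<lambda>p. ?U ^ p / fact p * (1 / (1 - ?V)) ^ Suc p) summable_on UNIV"
      using outer has_sum_imp_summable by blast
    show "norm (?f ?u ?v (p, k)) \<le> Re (?f ?U ?V (p, k))" for p k
    proof -
      have "?f ?U ?V (p, k) = of_real (norm (?f ?u ?v (p, k)))"
        by (simp add: norm_mult norm_divide norm_power)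
      then show ?thesis by simp
    qed
  qed (use inner[OF cz] outer in auto)
  then have "((\<lambda>l. \<Sum>k\<le>l. ?f ?u ?v (l - k, k)) has_sum 1 / (1 - ?v) * exp (?u / (1 - ?v))) UNIV"
    using has_sum_antidiagonal by fastforce
  also have "(\<lambda>l. \<Sum>k\<le>l. ?f ?u ?v (l - k, k)) = (\<lambda>l. c ^ l / fact l * complex_hermite l l x y z)"
  proof
    fix l
    have "?f ?u ?v (l - k, k) = c ^ l / fact l *
        (fact k * of_nat (l choose k) * of_nat (l choose k) * x ^ (l - k) * y ^ (l - k) * z ^ k)"
      if "k \<le> l" for k
    proof -
      have "c ^ l = c ^ (l - k) * c ^ k" using that by (simp flip: power_add)
      then show ?thesis
        using that by (simp add: binomial_fact power_mult_distrib)
    qed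
    then show "(\<Sum>k\<le>l. ?f ?u ?v (l - k, k)) = c ^ l / fact l * complex_hermite l l x y z"
      unfolding complex_hermite_def sum_distrib_left by (intro sum.cong) auto
  qed
  finally show ?thesis .
qed

lemma has_sum_hermite_mehler:
  assumes cz: "norm (c * z) < 1"
  shows "((\<lambda>(m, n). complex_hermite m n x y z * (complex_hermite m n a b c / (fact m * fact n))) has_sum
     1 / (1 - c * z) * exp ((a * x + b * y + c * x * y + a * b * z) / (1 - c * z))) UNIV"
proof -
  let ?f = "\<lambda>x y z a b c (l, p). c ^ l / fact l * hermite_term x y z a b l l p"
  let ?g = "\<lambda>x y z a b c l. c ^ l / fact l * complex_hermite l l (x + b * z) (y + a * z) z *
      exp (a * x + b * y + a * b * z)"
  let ?S = "\<lambda>x y z a b c. 1 / (1 - c * z) * exp (c * (x + b * z) * (y + a * z) / (1 - c * z)) *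
      exp (a * x + b * y + a * b * z)"
  have inner: "((\<lambda>p. ?f x y z a b c (l, p)) has_sum ?g x y z a b c l) UNIV" for x y z a b c l
    using has_sum_cmult_right[OF has_sum_hermite_term, of "c ^ l / fact l"] by (simp only: prod.case mult.assoc)
  have outer: "(?g x y z a b c has_sum ?S x y z a b c) UNIV" if "norm (c * z) < 1" for x y z a b c
    using that by (intro has_sum_cmult_left has_sum_diagonal_hermite)
  have "(?f x y z a b c has_sum ?S x y z a b c) (UNIV \<times> UNIV)"
  proof (rule has_sum_Sigma_dominated)
    let ?n = "\<lambda>w. of_real (norm w) :: complex"
    show "((\<lambda>p. ?f (?n x) (?n y) (?n z) (?n a) (?n b) (?n c) (l, p)) has_sum
        ?g (?n x) (?n y) (?n z) (?n a) (?n b) (?n c) l) UNIV" for l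
      by (rule inner)
    have "norm (?n c * ?n z) < 1" using cz by (simp add: norm_mult)
    then show "?g (?n x) (?n y) (?n z) (?n a) (?n b) (?n c) summable_on UNIV"
      using outer has_sum_imp_summable by blast
    show "norm (?f x y z a b c (l, p)) \<le> Re (?f (?n x) (?n y) (?n z) (?n a) (?n b) (?n c) (l, p))" for l p
    proof -
      obtain m n where p: "p = (m, n)" by (cases p)
      have "?f (?n x) (?n y) (?n z) (?n a) (?n b) (?n c) (l, p) =
          of_real (norm c ^ l / fact l * (real_hermite (m + l) (n + l) (norm x) (norm y) (norm z) *
            norm a ^ m * norm b ^ n / (fact m * fact n)))"
        by (simp add: p hermite_term_def complex_hermite_of_real)
      then have "Re (?f (?n x) (?n y) (?n z) (?n a) (?n b) (?n c) (l, p)) =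
          norm c ^ l / fact l * (real_hermite (m + l) (n + l) (norm x) (norm y) (norm z) *
            norm a ^ m * norm b ^ n / (fact m * fact n))"
        by (simp only: Re_complex_of_real)
      moreover have "norm (?f x y z a b c (l, p)) =
          norm c ^ l / fact l * (norm (complex_hermite (m + l) (n + l) x y z) *
            norm a ^ m * norm b ^ n / (fact m * fact n))"
        by (simp add: p hermite_term_def norm_mult norm_divide norm_power)
      ultimately show ?thesis
        by (simp only:) (intro mult_left_mono mult_right_mono divide_right_mono norm_complex_hermite_le; simp)
    qed
  qed (use inner outer[OF cz] in auto)
  then have "((\<lambda>(m, n). \<Sum>k = 0..min m n. ?f x y z a b c (k, m - k, n - k)) has_sum ?S x y z a b c) UNIV"
    using has_sum_diagonal_shift by fastforce
  \<comment> \<open>Only the polynomial in \<open>a\<close>, \<open>b\<close>, \<open>c\<close> is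
    expanded; the shift by \<open>k\<close> restores the indices \<open>m\<close>, \<open>n\<close>
    of the other one.\<close>
  also have "(\<lambda>(m, n). \<Sum>k = 0..min m n. ?f x y z a b c (k, m - k, n - k)) =
      (\<lambda>(m, n). complex_hermite m n x y z * (complex_hermite m n a b c / (fact m * fact n)))"
  proof (intro ext prod.case_cong refl)
    fix m n
    show "(\<Sum>k = 0..min m n. ?f x y z a b c (k, m - k, n - k)) =
        complex_hermite m n x y z * (complex_hermite m n a b c / (fact m * fact n))"
      unfolding complex_hermite_div_fact sum_distrib_left
      by (rule sum.cong) (auto simp: hermite_term_def mult_ac)
  qed
  also have "?S x y z a b c = 1 / (1 - c * z) * exp ((a * x + b * y + c * x * y + a * b * z) / (1 - c * z))"
  proof -
    have "1 - c * z \<noteq> 0" using cz by auto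
    \<comment> \<open>Over the denominator \<open>1 - c * z\<close> the terms
      \<open>c * z * (a * x + b * y)\<close> and \<open>a * b * c * z^2\<close> cancel.\<close>
    then have "c * (x + b * z) * (y + a * z) / (1 - c * z) + (a * x + b * y + a * b * z) =
        (a * x + b * y + c * x * y + a * b * z) / (1 - c * z)"
      by (simp add: divide_simps) (simp add: algebra_simps)
    then show ?thesis by (metis exp_add mult.assoc)
  qed
  finally show ?thesis .
qed

section \<open>Sums over blocks of multi-indices\<close>

lemma multi_indices_0: "multi_indices 0 = {\<lambda>_. undefined}"
  by (simp add: multi_indices_def)

text \<open>The last entries \<open>(i, k)\<close> of the two tuples are split off; the remaining
  entries have totals \<open>M - i\<close> and \<open>N - k\<close>.\<close>

lemma sum_index_block_Suc:
  fixes f :: "nat \<Rightarrow> nat \<Rightarrow> nat \<Rightarrow> complex"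
  shows "(\<Sum>(m, n)\<in>index_block (Suc r) (M, N). \<Prod>j = 1..Suc r. f j (m j) (n j)) =
    (\<Sum>i\<le>M. \<Sum>k\<le>N. f (Suc r) i k *
       (\<Sum>(m, n)\<in>index_block r (M - i, N - k). \<Prod>j = 1..r. f j (m j) (n j)))"
proof -
  let ?B = "SIGMA p:{..M} \<times> {..N}. index_block r (M - fst p, N - snd p)"
  \<comment> \<open>Resetting the last entry to \<open>undefined\<close> returns a tuple to
    \<open>multi_indices r\<close> and makes the splitting a bijection.\<close>
  let ?u = "\<lambda>m. m(Suc r := undefined)"
  have upd: "(\<Sum>j = 1..r. (m(Suc r := i)) j) = (\<Sum>j = 1..r. m j)" for m :: "nat \<Rightarrow> nat" and i
    by (rule sum.cong) auto
  have prod_upd: "(\<Prod>j = 1..r. f j ((m(Suc r := i)) j) ((n(Suc r := k)) j)) =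
      (\<Prod>j = 1..r. f j (m j) (n j))" for m n :: "nat \<Rightarrow> nat" and i k
    by (rule prod.cong) auto
  have extend: "m(Suc r := i) \<in> multi_indices (Suc r)" and undef: "?u m = m"
    if "m \<in> multi_indices r" for m i
    using that by (auto simp: multi_indices_def PiE_def extensional_def fun_eq_iff)
  have restrict: "?u m' \<in> multi_indices r" if "m' \<in> multi_indices (Suc r)" for m'
    using that by (auto simp: multi_indices_def PiE_def extensional_def)
  have "(\<Sum>(m, n)\<in>index_block (Suc r) (M, N). \<Prod>j = 1..Suc r. f j (m j) (n j)) =
      (\<Sum>((i, k), m, n)\<in>?B. f (Suc r) i k * (\<Prod>j = 1..r. f j (m j) (n j)))"
    by (rule sum.reindex_bij_witness
        [where i = "\<lambda>((i, k), m, n). (m(Suc r := i), n(Suc r := k))"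
          and j = "\<lambda>(m, n). ((m (Suc r), n (Suc r)), (?u m, ?u n))"])
      (auto simp: index_block_def upd prod_upd extend restrict undef mult.commute simp del: fun_upd_apply,
       auto simp: fun_upd_same)
  also have "\<dots> = (\<Sum>p\<in>{..M} \<times> {..N}. \<Sum>(m, n)\<in>index_block r (M - fst p, N - snd p).
      f (Suc r) (fst p) (snd p) * (\<Prod>j = 1..r. f j (m j) (n j)))"
    by (subst sum.Sigma) (auto simp: finite_index_block case_prod_unfold)
  finally show ?thesis
    by (simp add: sum.cartesian_product sum_distrib_left case_prod_unfold)
qed

text \<open>Splitting off the last entries gives the convolution of the addition formula, so the
  parameters add up. For \<open>r = 0\<close> both sides are the indicator of
  \<open>M = N = 0\<close>.\<close>

lemma sum_index_block_hermite:
  "(\<Sum>(m, n)\<in>index_block r (M, N).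
      \<Prod>j = 1..r. complex_hermite (m j) (n j) (xs j) (ys j) (zs j) / (fact (m j) * fact (n j))) =
    complex_hermite M N (\<Sum>j = 1..r. xs j) (\<Sum>j = 1..r. ys j) (\<Sum>j = 1..r. zs j) / (fact M * fact N)"
proof (induction r arbitrary: M N)
  case 0
  have "index_block 0 (M, N) = (if M = 0 \<and> N = 0 then {(\<lambda>_. undefined, \<lambda>_. undefined)} else {})"
    by (auto simp: index_block_def multi_indices_0)
  moreover have "complex_hermite M N 0 0 0 = (if M = 0 \<and> N = 0 then 1 else 0)"
  proof -
    have "0 ^ (M - k) * 0 ^ (N - k) * (0 :: complex) ^ k = 0" if "M \<noteq> 0 \<or> N \<noteq> 0" for k
      using that by (cases "k = 0") auto
    then show ?thesis
      by (auto simp: complex_hermite_def mult.assoc intro!: sum.neutral)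
  qed
  ultimately show ?case by simp
next
  case (Suc r)
  show ?case
    by (subst sum_index_block_Suc)
      (simp add: Suc.IH complex_hermite_add add.commute[of "sum _ _"] del: One_nat_def)
qed

section \<open>The multilinear generating function\<close>

text \<open>Grouped by totals, the blocks collapse to the bilinear series, governed by
  \<open>norm (c * z) < 1\<close>. Summing over individual tuples allows no cancellation within a
  block: the majorant is the series at absolute values, where \<open>c * z\<close> becomes the sum
  of the norms of \<open>s j * t j * zs j * z\<close>.\<close>

theorem theorem6p1:
  fixes r :: nat
    and x y z a b c :: complex
    and s t xs ys zs :: "nat \<Rightarrow> complex"
    and T :: "(nat \<Rightarrow> nat) \<times> (nat \<Rightarrow> nat) \<Rightarrow> complex"
  assumes r: "r \<ge> 1"
    and a: "a = (\<Sum>j = 1..r. s j * xs j)"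
    and b: "b = (\<Sum>j = 1..r. t j * ys j)"
    and c: "c = (\<Sum>j = 1..r. s j * t j * zs j)"
    and norm_c: "norm (\<Sum>j = 1..r. s j * t j * zs j) < 1"
    and norm_cz: "norm (c * z) < 1"
    and T: "\<And>m n. T (m, n) =
      (\<Prod>j = 1..r. complex_hermite (m j) (n j) (xs j) (ys j) (zs j)) *
      complex_hermite (\<Sum>j = 1..r. m j) (\<Sum>j = 1..r. n j) x y z *
      (\<Prod>j = 1..r. s j ^ m j * t j ^ n j / (fact (m j) * fact (n j)))"
  shows "((\<lambda>p. \<Sum>q\<in>index_block r p. T q) has_sum
           1 / (1 - c * z) * exp ((a * x + b * y + c * x * y + a * b * z) / (1 - c * z))) UNIV
    \<and> ((\<Sum>j = 1..r. norm (s j * t j * zs j * z)) < 1 \<longrightarrow>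
         (T has_sum
           1 / (1 - c * z) * exp ((a * x + b * y + c * x * y + a * b * z) / (1 - c * z)))
         (multi_indices r \<times> multi_indices r))"
proof
  let ?E = "1 / (1 - c * z) * exp ((a * x + b * y + c * x * y + a * b * z) / (1 - c * z))"
  \<comment> \<open>The parameters are arbitrary because this serves both the given data and their
    absolute values. Homogeneity absorbs the powers of \<open>s j\<close> and \<open>t j\<close>;
    the factor in \<open>x\<close>, \<open>y\<close>, \<open>z\<close> is constant on a
    block.\<close>
  have block: "(\<Sum>q\<in>index_block r (M, N).
      (\<Prod>j = 1..r. complex_hermite (fst q j) (snd q j) (xs j) (ys j) (zs j)) *
      complex_hermite (\<Sum>j = 1..r. fst q j) (\<Sum>j = 1..r. snd q j) x y z *
      (\<Prod>j = 1..r. s j ^ fst q j * t j ^ snd q j / (fact (fst q j) * fact (snd q j)))) =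
      complex_hermite M N x y z * (complex_hermite M N (\<Sum>j = 1..r. s j * xs j) (\<Sum>j = 1..r. t j * ys j)
        (\<Sum>j = 1..r. s j * t j * zs j) / (fact M * fact N))"
    (is "sum (?T s t xs ys zs x y z) _ = _") for M N s t xs ys zs x y z
  proof -
    have "(\<Sum>q\<in>index_block r (M, N). ?T s t xs ys zs x y z q) =
        complex_hermite M N x y z * (\<Sum>(m, n)\<in>index_block r (M, N).
        (\<Prod>j = 1..r. complex_hermite (m j) (n j) (s j * xs j) (t j * ys j) (s j * t j * zs j) /
          (fact (m j) * fact (n j))))"
      unfolding complex_hermite_scale sum_distrib_left
      by (rule sum.cong) (auto simp: index_block_def prod.distrib prod_dividef mult_ac)
    then show ?thesis
      by (simp only: sum_index_block_hermite)
  qed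
  have mehler: "((\<lambda>p. \<Sum>q\<in>index_block r p. ?T s t xs ys zs x y z q) has_sum
      1 / (1 - c * z) * exp ((a * x + b * y + c * x * y + a * b * z) / (1 - c * z))) UNIV"
    if "norm (c * z) < 1" "a = (\<Sum>j = 1..r. s j * xs j)" "b = (\<Sum>j = 1..r. t j * ys j)"
      "c = (\<Sum>j = 1..r. s j * t j * zs j)" for a b c s t xs ys zs x y z
  proof -
    have "(\<lambda>p. \<Sum>q\<in>index_block r p. ?T s t xs ys zs x y z q) =
        (\<lambda>(m, n). complex_hermite m n x y z * (complex_hermite m n a b c / (fact m * fact n)))"
    proof
      fix p :: "nat \<times> nat"
      obtain M N where p: "p = (M, N)" by (cases p)
      show "(\<Sum>q\<in>index_block r p. ?T s t xs ys zs x y z q) =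
          (case p of (m, n) \<Rightarrow> complex_hermite m n x y z * (complex_hermite m n a b c / (fact m * fact n)))"
        unfolding p prod.case that(2-4) by (rule block)
    qed
    then show ?thesis
      using has_sum_hermite_mehler[OF that(1)] by (simp only:)
  qed
  have T_eq: "T q = ?T s t xs ys zs x y z q" for q
    using T[of "fst q" "snd q"] by simp
  show blocks: "((\<lambda>p. \<Sum>q\<in>index_block r p. T q) has_sum ?E) UNIV"
    unfolding T_eq using norm_cz a b c by (rule mehler)
  show "(\<Sum>j = 1..r. norm (s j * t j * zs j * z)) < 1 \<longrightarrow>
      (T has_sum ?E) (multi_indices r \<times> multi_indices r)"
  proof
    assume less: "(\<Sum>j = 1..r. norm (s j * t j * zs j * z)) < 1"
    let ?n = "\<lambda>w. of_real (norm w) :: complex"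
    \<comment> \<open>The majorant is the same term with every parameter replaced by its absolute
      value.\<close>
    define H where "H = ?T (\<lambda>j. ?n (s j)) (\<lambda>j. ?n (t j)) (\<lambda>j. ?n (xs j)) (\<lambda>j. ?n (ys j))
      (\<lambda>j. ?n (zs j)) (?n x) (?n y) (?n z)"
    have "norm ((\<Sum>j = 1..r. ?n (s j) * ?n (t j) * ?n (zs j)) * ?n z) < 1"
    proof -
      have "(\<Sum>j = 1..r. ?n (s j) * ?n (t j) * ?n (zs j)) * ?n z =
          of_real (\<Sum>j = 1..r. norm (s j * t j * zs j * z))"
        by (simp add: norm_mult sum_distrib_right)
      then show ?thesis
        using less by (simp only: norm_of_real) (simp add: sum_nonneg)
    qed
    then have "(\<lambda>p. \<Sum>q\<in>index_block r p. H q) summable_on UNIV"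
      unfolding H_def by (intro has_sum_imp_summable[OF mehler]) auto
    moreover have "norm (T q) \<le> Re (H q)" for q
    proof -
      have "H q = of_real (
          (\<Prod>j = 1..r. real_hermite (fst q j) (snd q j) (norm (xs j)) (norm (ys j)) (norm (zs j))) *
          real_hermite (\<Sum>j = 1..r. fst q j) (\<Sum>j = 1..r. snd q j) (norm x) (norm y) (norm z) *
          (\<Prod>j = 1..r. norm (s j) ^ fst q j * norm (t j) ^ snd q j / (fact (fst q j) * fact (snd q j))))"
        by (simp add: H_def complex_hermite_of_real)
      then have H: "Re (H q) =
          (\<Prod>j = 1..r. real_hermite (fst q j) (snd q j) (norm (xs j)) (norm (ys j)) (norm (zs j))) *
          real_hermite (\<Sum>j = 1..r. fst q j) (\<Sum>j = 1..r. snd q j) (norm x) (norm y) (norm z) *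
          (\<Prod>j = 1..r. norm (s j) ^ fst q j * norm (t j) ^ snd q j / (fact (fst q j) * fact (snd q j)))"
        by (simp only: Re_complex_of_real)
      have nonneg: "0 \<le> real_hermite m n (norm x) (norm y) (norm z)" for m n and x y z :: complex
        by (rule order_trans[OF norm_ge_zero norm_complex_hermite_le])
      show ?thesis
        unfolding H T_eq norm_mult prod_norm[symmetric] norm_divide norm_power norm_fact
        by (intro mult_mono prod_mono mult_nonneg_nonneg prod_nonneg conjI norm_complex_hermite_le
            ballI nonneg norm_ge_zero order_refl divide_nonneg_nonneg zero_le_power fact_ge_zero)
    qed
    \<comment> \<open>Inner sums run over the finite blocks and outer sums over the totals
      \<open>p\<close>.\<close>
    ultimately have "((\<lambda>(p, q). T q) has_sum ?E) (SIGMA p:UNIV. index_block r p)"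
      by (intro has_sum_Sigma_dominated[OF _ blocks, where h = "\<lambda>(p, q). H q"])
        (auto intro!: has_sum_finite finite_index_block)
    \<comment> \<open>Each pair of tuples lies in exactly one block, the one given by its
      totals.\<close>
    also have "?this \<longleftrightarrow> (T has_sum ?E) (multi_indices r \<times> multi_indices r)"
      by (rule has_sum_reindex_bij_witness
          [where i = "\<lambda>(m, n). (((\<Sum>j = 1..r. m j), (\<Sum>j = 1..r. n j)), (m, n))" and j = snd])
        (auto simp: index_block_def)
    finally show "(T has_sum ?E) (multi_indices r \<times> multi_indices r)" .
  qed
qed

end
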